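(* Let $k$ be a field (not necessarily algebraically closed) and let $I \subset k[X_1,\ldots,X_n]$ be an ideal. Then the following are equivalent: (i) for each polynomial $f(X_1,\ldots,X_n) \in I$ there exists $a=(a_1,\ldots,a_n)\in k^n$ (possibly depending on $f$) such that $f(a)=0$; (ii) the algebraic set $V(I)$ determined by $I$ is non-empty.
   Context: For an ideal $I\subset k[X_1,\ldots,X_n]$, the algebraic set determined by $I$ is its set of common $k$-rational zeros, $V(I)=\{a\in k^n : g(a)=0 \text{ for all } g\in I\}$. *)

theory Defs
  imports "HOL-Library.Poly_Mapping" "HOL-Analysis.Finite_Cartesian_Product"
begin

text \<open>
  The type below is the monoid algebra of the free commutative monoid on \<open>'n\<close>, i.e. the
  polynomial ring with one variable for each element of the finite type \<open>'n\<close>: a monomial is its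
  finitely supported exponent vector, a polynomial is its finitely supported family of
  coefficients. Poly_Mapping supplies the ring structure (convolution product).
\<close>

type_synonym ('k, 'n) mpoly = "('n \<Rightarrow>\<^sub>0 nat) \<Rightarrow>\<^sub>0 'k"

definition mpoly_eval :: "('k::field, 'n::finite) mpoly \<Rightarrow> 'k ^ 'n \<Rightarrow> 'k" where
  "mpoly_eval f a =
     (\<Sum>m\<in>Poly_Mapping.keys f.
        Poly_Mapping.lookup f m * (\<Prod>i\<in>UNIV. (a $ i) ^ Poly_Mapping.lookup m i))"

definition is_ideal :: "'a::comm_ring_1 set \<Rightarrow> bool" where
  "is_ideal I \<longleftrightarrow>
     0 \<in> I \<and> (\<forall>f\<in>I. \<forall>g\<in>I. f + g \<in> I) \<and> (\<forall>r. \<forall>f\<in>I. r * f \<in> I)"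

lemma is_ideal_iff_submodule: "is_ideal I \<longleftrightarrow> module.subspace (*) I"
proof -
  interpret module "(*) :: 'a \<Rightarrow> 'a \<Rightarrow> 'a"
    by standard (simp_all add: algebra_simps)
  show ?thesis by (simp add: is_ideal_def subspace_def)
qed

definition algebraic_set :: "('k::field, 'n::finite) mpoly set \<Rightarrow> ('k ^ 'n) set" where
  "algebraic_set I = {a. \<forall>g\<in>I. mpoly_eval g a = 0}"

end

theory Submission
  imports Defs "HOL-Computational_Algebra.Polynomial"
begin

text \<open>
  If \<open>k\<close> is algebraically closed, (i) excludes \<open>1 \<in> I\<close>, and the claim is the weak Nullstellensatz.
  For a prime \<open>P \<supseteq> I\<close> a common zero is built one coordinate at a time: given a polynomial \<open>b \<notin> P\<close>
  in the variables seen so far, there is some \<open>a \<notin> P\<close> in one variable fewer such that every zero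
  of the elimination ideal of \<open>P\<close> at which \<open>a\<close> does not vanish extends to a zero at which \<open>b\<close> does
  not vanish.

  If \<open>k\<close> is not algebraically closed, homogenizing a univariate polynomial without roots gives a
  form \<open>H(u, v)\<close> whose only zero is the origin, so \<open>V(H(f, g)) = V(f) \<inter> V(g)\<close>. Hence finitely many
  elements of \<open>I\<close> have the same common zeros as a single one, which has a zero by (i); finitely
  many suffice by Hilbert's basis theorem.
\<close>

hide_const (open) Poly_Mapping.degree

section \<open>Subrings and polynomials over them\<close>

text \<open>Subrings are sets inside one ambient type, so that rings in fewer variables are subsets
  of the full polynomial ring.\<close>

definition is_subring :: "'a::comm_ring_1 set \<Rightarrow> bool" where
  "is_subring A \<longleftrightarrow> 1 \<in> A \<and> (\<forall>x\<in>A. \<forall>y\<in>A. x - y \<in> A \<and> x * y \<in> A)"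

text \<open>For a subring \<open>A\<close> this is A[X]. It is also applied to an ideal
  \<open>P\<close>, where membership says that the polynomial is trivial modulo
  \<open>P\<close>.\<close>

definition polys_over :: "'a::comm_ring_1 set \<Rightarrow> 'a poly set" where
  "polys_over A = {p. \<forall>i. coeff p i \<in> A}"

lemma is_subringD:
  assumes "is_subring A"
  shows is_subring_one: "1 \<in> A"
    and is_subring_zero: "0 \<in> A"
    and is_subring_diff: "x \<in> A \<Longrightarrow> y \<in> A \<Longrightarrow> x - y \<in> A"
    and is_subring_mult: "x \<in> A \<Longrightarrow> y \<in> A \<Longrightarrow> x * y \<in> A"
    and is_subring_uminus: "x \<in> A \<Longrightarrow> - x \<in> A"
    and is_subring_add: "x \<in> A \<Longrightarrow> y \<in> A \<Longrightarrow> x + y \<in> A"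
proof -
  show 1: "1 \<in> A" using assms unfolding is_subring_def by blast
  have d: "x - y \<in> A" if "x \<in> A" "y \<in> A" for x y
    using assms that unfolding is_subring_def by blast
  show z: "0 \<in> A" using d[OF 1 1] by simp
  have u: "- x \<in> A" if "x \<in> A" for x
    using d[OF z that] by simp
  show "x \<in> A \<Longrightarrow> y \<in> A \<Longrightarrow> x - y \<in> A" by (rule d)
  show "x \<in> A \<Longrightarrow> y \<in> A \<Longrightarrow> x * y \<in> A" using assms unfolding is_subring_def by blast
  show "x \<in> A \<Longrightarrow> - x \<in> A" by (rule u)
  show "x \<in> A \<Longrightarrow> y \<in> A \<Longrightarrow> x + y \<in> A" using d[of x "- y"] u[of y] by simp
qed

lemma is_subring_sum:
  assumes "is_subring A" "\<And>i. i \<in> S \<Longrightarrow> f i \<in> A"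
  shows "sum f S \<in> A"
  using assms(2)
  by (induction S rule: infinite_finite_induct)
    (auto intro: is_subring_zero[OF assms(1)] is_subring_add[OF assms(1)])

lemma is_subring_power:
  assumes "is_subring A" "x \<in> A"
  shows "x ^ n \<in> A"
  by (induction n) (auto intro: is_subringD[OF assms(1)] assms(2))

lemma coeff_polys_over: "p \<in> polys_over A \<Longrightarrow> coeff p i \<in> A"
  by (simp add: polys_over_def)

lemma is_subring_polys_over:
  assumes "is_subring A"
  shows "is_subring (polys_over A)"
  unfolding is_subring_def polys_over_def
  by (auto simp: coeff_mult coeff_1
      intro!: is_subring_sum[OF assms] is_subringD(1-4)[OF assms])

lemma monom_polys_over:
  assumes "is_subring A" "c \<in> A"
  shows "monom c n \<in> polys_over A"
  using assms by (auto simp: polys_over_def intro: is_subring_zero)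

lemma smult_polys_over:
  assumes "is_subring A" "c \<in> A" "p \<in> polys_over A"
  shows "smult c p \<in> polys_over A"
  using assms by (auto simp: polys_over_def intro: is_subring_mult)

text \<open>The image is A[x], the ring obtained by adjoining \<open>x\<close> to
  \<open>A\<close>.\<close>

lemma is_subring_image_poly:
  assumes "is_subring A"
  shows "is_subring ((\<lambda>p. poly p x) ` polys_over A)"
proof -
  note PA = is_subring_polys_over[OF assms]
  show ?thesis
    unfolding is_subring_def
  proof (intro conjI ballI)
    show "1 \<in> (\<lambda>p. poly p x) ` polys_over A"
      by (rule image_eqI[of _ _ 1]) (simp_all add: is_subring_one[OF PA])
  next
    fix u v assume "u \<in> (\<lambda>p. poly p x) ` polys_over A" "v \<in> (\<lambda>p. poly p x) ` polys_over A"
    then obtain p q where "p \<in> polys_over A" "q \<in> polys_over A" "u = poly p x" "v = poly q x"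
      by blast
    then show "u - v \<in> (\<lambda>p. poly p x) ` polys_over A" "u * v \<in> (\<lambda>p. poly p x) ` polys_over A"
      by (auto simp flip: poly_diff poly_mult intro!: imageI is_subringD(3,4)[OF PA])
  qed
qed

lemma subset_image_poly:
  assumes "is_subring A"
  shows "A \<subseteq> (\<lambda>p. poly p x) ` polys_over A"
proof
  fix c assume "c \<in> A"
  then show "c \<in> (\<lambda>p. poly p x) ` polys_over A"
    by (intro image_eqI[of _ _ "monom c 0"] monom_polys_over[OF assms]) (simp_all add: poly_monom)
qed

lemma generator_in_image_poly:
  assumes "is_subring A"
  shows "x \<in> (\<lambda>p. poly p x) ` polys_over A"
  by (intro image_eqI[of _ _ "monom 1 1"] monom_polys_over[OF assms] is_subring_one[OF assms])
    (simp add: poly_monom)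

section \<open>Pseudo-division over a subring\<close>

lemma degree_eliminate_lead_coeff:
  fixes f g :: "'a::comm_ring_1 poly"
  assumes "degree g \<le> degree f" "0 < degree f"
  shows "degree (smult (lead_coeff g) f - monom (lead_coeff f) (degree f - degree g) * g) < degree f"
    (is "degree ?r < _")
proof (rule ccontr)
  assume *: "\<not> degree ?r < degree f"
  have "degree (monom (lead_coeff f) (degree f - degree g) * g) \<le> degree f"
    by (rule order.trans[OF degree_mult_le]) (use assms degree_monom_le[of "lead_coeff f" "degree f - degree g"] in linarith)
  then have "degree ?r \<le> degree f"
    by (intro degree_diff_le) (auto intro: order.trans[OF degree_smult_le])
  with * have d: "degree ?r = degree f" by simp
  have "coeff ?r (degree f) = 0"
    using assms by (simp add: coeff_monom_mult)
  \<comment> \<open>Only the zero polynomial has leading coefficient 0, and its degree contradicts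
    \<open>0 < degree f\<close>.\<close>
  with d have "?r = 0" by (metis leading_coeff_0_iff)
  with d assms show False by simp
qed

text \<open>Cross-multiplying leading terms replaces division of coefficients, at the cost of a
  factor \<open>lead_coeff g\<close> per round. The bound on \<open>degree h\<close> is needed when
  a minimal relation is divided by a polynomial of smaller degree.\<close>

lemma pseudo_division_over:
  fixes f g :: "'a::comm_ring_1 poly"
  assumes A: "is_subring A" and f: "f \<in> polys_over A" and g: "g \<in> polys_over A" and "0 < degree g"
  shows "\<exists>N h r. h \<in> polys_over A \<and> r \<in> polys_over A \<and> smult (lead_coeff g ^ N) f = g * h + r \<and>
    degree r < degree g \<and> degree h \<le> degree f - degree g"
  using f
proof (induction "degree f" arbitrary: f rule: less_induct)
  case less
  note PA = is_subring_polys_over[OF A]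
  show ?case
  proof (cases "degree f < degree g")
    case True
    then show ?thesis using less.prems is_subring_zero[OF PA]
      by (intro exI[of _ 0] exI[of _ 0] exI[of _ f]) auto
  next
    case False
    define l where "l = lead_coeff g"
    define m where "m = monom (lead_coeff f) (degree f - degree g)"
    define f' where "f' = smult l f - m * g"
    have "l \<in> A" "lead_coeff f \<in> A" unfolding l_def using g less.prems by (auto intro: coeff_polys_over)
    then have m: "m \<in> polys_over A" unfolding m_def by (intro monom_polys_over A)
    have f': "f' \<in> polys_over A" unfolding f'_def
      by (intro is_subringD(3,4)[OF PA] smult_polys_over A \<open>l \<in> A\<close> less.prems m g)
    have lt: "degree f' < degree f"
      unfolding f'_def m_def l_def using False assms(4) by (intro degree_eliminate_lead_coeff) auto
    from less.hyps[OF lt f'] obtain N h r where *: "h \<in> polys_over A" "r \<in> polys_over A"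
      "smult (l ^ N) f' = g * h + r" "degree r < degree g" "degree h \<le> degree f' - degree g"
      unfolding l_def by blast
    have "smult (l ^ Suc N) f = smult (l ^ N) f' + smult (l ^ N) (m * g)"
      unfolding f'_def by (simp add: smult_diff_right mult.commute)
    also have "\<dots> = g * (h + smult (l ^ N) m) + r"
      using *(3) by (simp add: algebra_simps)
    finally have "smult (l ^ Suc N) f = g * (h + smult (l ^ N) m) + r" .
    moreover have "degree (h + smult (l ^ N) m) \<le> degree f - degree g"
    proof (rule degree_add_le)
      show "degree h \<le> degree f - degree g" using *(5) lt by linarith
      show "degree (smult (l ^ N) m) \<le> degree f - degree g"
        unfolding m_def by (rule order.trans[OF degree_smult_le degree_monom_le])
    qed
    moreover have "h + smult (l ^ N) m \<in> polys_over A"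
      by (intro is_subring_add[OF PA] smult_polys_over A is_subring_power \<open>l \<in> A\<close> m *)
    ultimately show ?thesis using * unfolding l_def by blast
  qed
qed

section \<open>Noetherian subrings\<close>

text \<open>The \<open>A\<close>-submodule generated by \<open>F\<close>; an ideal of
  \<open>A\<close> when \<open>F\<close> lies in the subring \<open>A\<close>.\<close>

inductive_set ideal_over :: "'a::comm_ring_1 set \<Rightarrow> 'a set \<Rightarrow> 'a set" for A F where
  zero: "0 \<in> ideal_over A F"
| gen: "x \<in> F \<Longrightarrow> x \<in> ideal_over A F"
| add: "x \<in> ideal_over A F \<Longrightarrow> y \<in> ideal_over A F \<Longrightarrow> x + y \<in> ideal_over A F"
| scale: "a \<in> A \<Longrightarrow> x \<in> ideal_over A F \<Longrightarrow> a * x \<in> ideal_over A F"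

lemma ideal_over_least:
  assumes "F \<subseteq> ideal_over A G"
  shows "ideal_over A F \<subseteq> ideal_over A G"
proof
  fix x assume "x \<in> ideal_over A F"
  then show "x \<in> ideal_over A G"
    by induction (use assms in \<open>auto intro: ideal_over.intros\<close>)
qed

lemma ideal_over_mono: "F \<subseteq> G \<Longrightarrow> ideal_over A F \<subseteq> ideal_over A G"
  by (rule ideal_over_least) (auto intro: ideal_over.gen)

lemma ideal_over_diff:
  assumes "is_subring A" "x \<in> ideal_over A F" "y \<in> ideal_over A F"
  shows "x - y \<in> ideal_over A F"
proof -
  have "- 1 * y \<in> ideal_over A F"
    using assms by (intro ideal_over.scale is_subringD(5,1))
  from ideal_over.add[OF assms(2) this] show ?thesis by simp
qed

lemma ideal_over_subset:
  assumes "is_subring A" "F \<subseteq> A"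
  shows "ideal_over A F \<subseteq> A"
proof
  fix x assume "x \<in> ideal_over A F"
  then show "x \<in> A"
    by induction (use assms in \<open>auto intro: is_subringD\<close>)
qed

lemma ideal_over_finite_support:
  assumes "x \<in> ideal_over A I"
  shows "\<exists>F\<subseteq>I. finite F \<and> x \<in> ideal_over A F"
  using assms
proof induction
  case zero
  show ?case by (intro exI[of _ "{}"]) (auto intro: ideal_over.zero)
next
  case (gen x)
  then show ?case by (intro exI[of _ "{x}"]) (auto intro: ideal_over.gen)
next
  case (add x y)
  then obtain F G where "F \<subseteq> I" "finite F" "x \<in> ideal_over A F" "G \<subseteq> I" "finite G" "y \<in> ideal_over A G"
    by blast
  then show ?case
    using ideal_over_mono[of F "F \<union> G" A] ideal_over_mono[of G "F \<union> G" A]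
    by (intro exI[of _ "F \<union> G"]) (auto intro: ideal_over.add)
next
  case (scale a x)
  then show ?case by (blast intro: ideal_over.scale)
qed

lemma ideal_over_finite_support_subset:
  assumes "finite G" "G \<subseteq> ideal_over A I"
  shows "\<exists>F\<subseteq>I. finite F \<and> G \<subseteq> ideal_over A F"
proof -
  obtain S where S: "\<And>x. x \<in> G \<Longrightarrow> S x \<subseteq> I \<and> finite (S x) \<and> x \<in> ideal_over A (S x)"
    using ideal_over_finite_support assms(2) by (metis subsetD)
  have "x \<in> ideal_over A (\<Union>(S ` G))" if "x \<in> G" for x
    using S[OF that] that ideal_over_mono[of "S x" "\<Union>(S ` G)" A] by blast
  then show ?thesis using S assms(1) by (intro exI[of _ "\<Union>(S ` G)"]) blast
qed

text \<open>Arbitrary subsets \<open>I\<close> are allowed, not only ideals. For a subring this is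
  equivalent to finite generation of its ideals, and it picks the generators from \<open>I\<close>
  itself.\<close>

definition noetherian_on :: "'a::comm_ring_1 set \<Rightarrow> bool" where
  "noetherian_on A \<longleftrightarrow> (\<forall>I\<subseteq>A. \<exists>F\<subseteq>I. finite F \<and> I \<subseteq> ideal_over A F)"

lemma noetherian_onE:
  assumes "noetherian_on A" "I \<subseteq> A"
  obtains F where "F \<subseteq> I" "finite F" "I \<subseteq> ideal_over A F"
  using assms unfolding noetherian_on_def by metis

text \<open>Finitely many members of the sequence generate all of it; \<open>N\<close> bounds their
  indices.\<close>

lemma noetherian_on_sequence:
  assumes "noetherian_on A" "range f \<subseteq> A"
  shows "\<exists>N::nat. f N \<in> ideal_over A (f ` {..<N})"
proof -
  obtain F where F: "F \<subseteq> range f" "finite F" "range f \<subseteq> ideal_over A F"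
    using noetherian_onE[OF assms] .
  obtain T where T: "finite T" "F = f ` T" using F by (meson finite_subset_image)
  then obtain N where "T \<subseteq> {..<N}" using finite_nat_bounded by blast
  then have "ideal_over A F \<subseteq> ideal_over A (f ` {..<N})"
    using T by (intro ideal_over_mono) auto
  then show ?thesis using F by blast
qed

text \<open>Hilbert's argument with a sequence of polynomials each of minimal degree outside the ideal
  generated by its predecessors: some leading coefficient is a combination of the earlier ones,
  and subtracting the corresponding combination of polynomials lowers the degree.\<close>

lemma noetherian_on_polys_over:
  assumes A: "is_subring A" and noeth: "noetherian_on A"
  shows "noetherian_on (polys_over A)"
proof (rule ccontr)
  note PA = is_subring_polys_over[OF A]
  let ?P = "polys_over A"
  assume "\<not> noetherian_on ?P"
  then obtain I where I: "I \<subseteq> ?P" "\<And>F. F \<subseteq> I \<Longrightarrow> finite F \<Longrightarrow> \<not> I \<subseteq> ideal_over ?P F"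
    unfolding noetherian_on_def by blast
  define J where "J = ideal_over ?P I"
  have IJ: "I \<subseteq> J" unfolding J_def by (auto intro: ideal_over.gen)
  have JP: "J \<subseteq> ?P" unfolding J_def by (rule ideal_over_subset[OF PA I(1)])
  \<comment> \<open>Finitely many elements of \<open>J\<close> are combinations of finitely many
    elements of \<open>I\<close>, and these do not generate \<open>I\<close>.\<close>
  have nfg: "\<exists>p. p \<in> J - ideal_over ?P G" if G: "finite G" "G \<subseteq> J" for G
  proof -
    obtain F where F: "F \<subseteq> I" "finite F" "G \<subseteq> ideal_over ?P F"
      using ideal_over_finite_support_subset[OF G(1), of ?P I] G(2) unfolding J_def by auto
    have "\<not> J \<subseteq> ideal_over ?P G"
      using ideal_over_least[OF F(3)] I(2)[OF F(1,2)] IJ by (meson order.trans)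
    then show ?thesis by blast
  qed
  \<comment> \<open>\<open>Q g n p\<close> depends on \<open>g\<close> only below \<open>n\<close>,
    as well-founded dependent choice requires.\<close>
  define Q where "Q = (\<lambda>(g::nat \<Rightarrow> 'a poly) n p. p \<in> J - ideal_over ?P (g ` {..<n}) \<and>
    (\<forall>q \<in> J - ideal_over ?P (g ` {..<n}). degree p \<le> degree q))"
  have "\<exists>g. \<forall>n. Q g n (g n)"
  proof (rule dependent_wf_choice[OF wf_less])
    fix f g :: "nat \<Rightarrow> 'a poly" and n r
    assume "\<And>z. (z, n) \<in> {(x, y). x < y} \<Longrightarrow> f z = g z"
    then have "f ` {..<n} = g ` {..<n}" by (intro image_cong) auto
    then show "Q f n r = Q g n r" unfolding Q_def by simp
  next
    fix n :: nat and f :: "nat \<Rightarrow> 'a poly"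
    assume "\<And>y. (y, n) \<in> {(x, y). x < y} \<Longrightarrow> Q f y (f y)"
    then have "f ` {..<n} \<subseteq> J" unfolding Q_def by auto
    then obtain p where p: "p \<in> J - ideal_over ?P (f ` {..<n})" using nfg by blast
    from ex_has_least_nat[of "\<lambda>p. p \<in> J - ideal_over ?P (f ` {..<n})", OF p]
    show "\<exists>r. Q f n r" unfolding Q_def by blast
  qed
  then obtain g where "\<forall>n. Q g n (g n)" by blast
  then have gJ: "g n \<in> J" and gn: "g n \<notin> ideal_over ?P (g ` {..<n})"
    and min: "q \<in> J \<Longrightarrow> q \<notin> ideal_over ?P (g ` {..<n}) \<Longrightarrow> degree (g n) \<le> degree q" for n q
    unfolding Q_def by blast+
  \<comment> \<open>The generated ideals grow with the index, so \<open>g n\<close> was already a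
    candidate at stage \<open>m\<close>.\<close>
  have mono: "degree (g m) \<le> degree (g n)" if "m \<le> n" for m n
  proof (rule min[OF gJ])
    have "g ` {..<m} \<subseteq> g ` {..<n}" using that by auto
    then show "g n \<notin> ideal_over ?P (g ` {..<m})"
      using gn[of n] ideal_over_mono[of "g ` {..<m}" "g ` {..<n}" ?P] by blast
  qed
  have gP: "g n \<in> ?P" for n using gJ JP by blast
  obtain N where N: "lead_coeff (g N) \<in> ideal_over A ((\<lambda>n. lead_coeff (g n)) ` {..<N})"
    using noetherian_on_sequence[OF noeth, of "\<lambda>n. lead_coeff (g n)"] gP coeff_polys_over by blast
  let ?d = "degree (g N)"
  \<comment> \<open>Combinations of leading coefficients lift to combinations of polynomials: powers
    of X bring the earlier polynomials up to degree \<open>?d\<close>, as degrees never decrease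
    along \<open>g\<close>. The coefficient at \<open>?d\<close> is tracked because top terms of a
    sum may cancel.\<close>
  have "\<exists>w \<in> ideal_over ?P (g ` {..<N}). degree w \<le> ?d \<and> coeff w ?d = z"
    if "z \<in> ideal_over A ((\<lambda>n. lead_coeff (g n)) ` {..<N})" for z
    using that
  proof induction
    case zero
    show ?case by (rule bexI[of _ 0]) (auto intro: ideal_over.zero)
  next
    case (gen z)
    then obtain i where i: "i < N" "z = lead_coeff (g i)" by blast
    have le: "degree (g i) \<le> ?d" using i mono by simp
    let ?w = "monom 1 (?d - degree (g i)) * g i"
    have "?w \<in> ideal_over ?P (g ` {..<N})"
      using i by (intro ideal_over.scale ideal_over.gen monom_polys_over[OF A] is_subring_one[OF A]) auto
    moreover have "degree ?w \<le> ?d"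
      by (rule order.trans[OF degree_mult_le])
        (use le degree_monom_le[of "1::'a" "?d - degree (g i)"] in linarith)
    moreover have "coeff ?w ?d = z" using le i by (simp add: coeff_monom_mult)
    ultimately show ?case by blast
  next
    case (add x y)
    then obtain v w where "v \<in> ideal_over ?P (g ` {..<N})" "degree v \<le> ?d" "coeff v ?d = x"
      "w \<in> ideal_over ?P (g ` {..<N})" "degree w \<le> ?d" "coeff w ?d = y" by blast
    then show ?case by (intro bexI[of _ "v + w"]) (auto intro: ideal_over.add degree_add_le)
  next
    case (scale a x)
    then obtain w where w: "w \<in> ideal_over ?P (g ` {..<N})" "degree w \<le> ?d" "coeff w ?d = x" by blast
    have "monom a 0 * w \<in> ideal_over ?P (g ` {..<N})"
      using w scale by (intro ideal_over.scale monom_polys_over[OF A])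
    moreover have "monom a 0 * w = smult a w" by (simp add: monom_0)
    ultimately have "smult a w \<in> ideal_over ?P (g ` {..<N})" by simp
    then show ?case using w order.trans[OF degree_smult_le, of w ?d a]
      by (intro bexI[of _ "smult a w"]) auto
  qed
  from this[OF N] obtain w where w: "w \<in> ideal_over ?P (g ` {..<N})" "degree w \<le> ?d"
    "coeff w ?d = lead_coeff (g N)" by blast
  have "ideal_over ?P (g ` {..<N}) \<subseteq> J"
    unfolding J_def by (rule ideal_over_least) (use gJ in \<open>auto simp: J_def\<close>)
  then have dJ: "g N - w \<in> J" using gJ w unfolding J_def by (auto intro: ideal_over_diff[OF PA])
  have dn: "g N - w \<notin> ideal_over ?P (g ` {..<N})"
    using gn[of N] w(1) ideal_over.add by fastforce
  have "degree (g N - w) \<le> ?d" using w by (intro degree_diff_le) auto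
  \<comment> \<open>Minimality keeps the degree at \<open>?d\<close>, where the coefficient has just
    been cancelled; so the difference is 0, which lies in every ideal.\<close>
  with min[OF dJ dn] have eq: "degree (g N - w) = ?d" by simp
  then have "coeff (g N - w) (degree (g N - w)) = 0" using w by simp
  then have "g N - w = 0" by (simp only: leading_coeff_0_iff)
  then show False using dn ideal_over.zero by metis
qed

text \<open>Generators of a preimage map to generators, as for any quotient of a Noetherian
  ring.\<close>

lemma noetherian_on_image_poly:
  assumes "noetherian_on (polys_over A)"
  shows "noetherian_on ((\<lambda>p. poly p x) ` polys_over A)"
  unfolding noetherian_on_def
proof (intro allI impI)
  let ?h = "\<lambda>p. poly p x" let ?P = "polys_over A"
  fix I assume "I \<subseteq> ?h ` ?P"
  then obtain I' where I': "I' \<subseteq> ?P" "I = ?h ` I'" by (meson subset_imageE)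
  obtain F where F: "F \<subseteq> I'" "finite F" "I' \<subseteq> ideal_over ?P F"
    using noetherian_onE[OF assms I'(1)] .
  have "?h p \<in> ideal_over (?h ` ?P) (?h ` F)" if "p \<in> ideal_over ?P F" for p
    using that by induction (auto intro: ideal_over.intros)
  then show "\<exists>F\<subseteq>I. finite F \<and> I \<subseteq> ideal_over (?h ` ?P) F"
    using F I' by (intro exI[of _ "?h ` F"]) auto
qed

section \<open>Prime ideals\<close>

definition is_prime_ideal :: "'a::comm_ring_1 set \<Rightarrow> bool" where
  "is_prime_ideal P \<longleftrightarrow> is_ideal P \<and> 1 \<notin> P \<and> (\<forall>a b. a * b \<in> P \<longrightarrow> a \<in> P \<or> b \<in> P)"

lemma is_idealD:
  assumes "is_ideal P"
  shows is_ideal_zero: "0 \<in> P"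
    and is_ideal_add: "f \<in> P \<Longrightarrow> g \<in> P \<Longrightarrow> f + g \<in> P"
    and is_ideal_mult_left: "f \<in> P \<Longrightarrow> r * f \<in> P"
    and is_ideal_mult_right: "f \<in> P \<Longrightarrow> f * r \<in> P"
    and is_ideal_uminus: "f \<in> P \<Longrightarrow> - f \<in> P"
    and is_ideal_diff: "f \<in> P \<Longrightarrow> g \<in> P \<Longrightarrow> f - g \<in> P"
proof -
  show "0 \<in> P" and a: "\<And>f g. f \<in> P \<Longrightarrow> g \<in> P \<Longrightarrow> f + g \<in> P"
    and m: "\<And>f r. f \<in> P \<Longrightarrow> r * f \<in> P"
    using assms unfolding is_ideal_def by blast+
  show "f \<in> P \<Longrightarrow> f * r \<in> P" using m[of f r] by (simp add: mult.commute)
  have u: "- f \<in> P" if "f \<in> P" for f using m[OF that, of "- 1"] by simp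
  show "f \<in> P \<Longrightarrow> - f \<in> P" by (rule u)
  show "f \<in> P \<Longrightarrow> g \<in> P \<Longrightarrow> f - g \<in> P" using a[of f "- g"] u[of g] by simp
qed

lemma is_ideal_sum:
  assumes "is_ideal P" "\<And>i. i \<in> S \<Longrightarrow> f i \<in> P"
  shows "sum f S \<in> P"
  using assms(2)
  by (induction S rule: infinite_finite_induct)
    (auto intro: is_ideal_zero[OF assms(1)] is_ideal_add[OF assms(1)])

text \<open>By Zorn's lemma there is an ideal \<open>M\<close> maximal among those that contain
  \<open>I\<close> but not 1, and such an \<open>M\<close> is prime.\<close>

lemma ex_prime_ideal:
  assumes I: "is_ideal I" "1 \<notin> I"
  obtains P where "is_prime_ideal P" "I \<subseteq> P"
proof -
  let ?\<A> = "{J. is_ideal J \<and> I \<subseteq> J \<and> 1 \<notin> J}"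
  have "\<exists>M\<in>?\<A>. \<forall>X\<in>?\<A>. M \<subseteq> X \<longrightarrow> X = M"
  proof (rule subset_Zorn_nonempty)
    show "?\<A> \<noteq> {}" using I by blast
  next
    fix C assume C: "C \<noteq> {}" "subset.chain ?\<A> C"
    then have CA: "\<And>J. J \<in> C \<Longrightarrow> is_ideal J \<and> I \<subseteq> J \<and> 1 \<notin> J"
      and lin: "\<And>J K. J \<in> C \<Longrightarrow> K \<in> C \<Longrightarrow> J \<subseteq> K \<or> K \<subseteq> J"
      unfolding subset.chain_def by auto
    have "f + g \<in> \<Union>C" if fg: "f \<in> \<Union>C" "g \<in> \<Union>C" for f g
    proof -
      obtain J K where "J \<in> C" "K \<in> C" "f \<in> J" "g \<in> K" using fg by blast
      then obtain L where "L \<in> C" "f \<in> L" "g \<in> L" using lin by blast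
      then show ?thesis using CA[of L] is_ideal_add by blast
    qed
    moreover have "r * f \<in> \<Union>C" if f: "f \<in> \<Union>C" for f r
      using f CA is_ideal_mult_left by blast
    moreover have "0 \<in> \<Union>C" using C CA is_ideal_zero by blast
    ultimately have "is_ideal (\<Union>C)" unfolding is_ideal_def by blast
    then show "\<Union>C \<in> ?\<A>" using C CA by blast
  qed
  then obtain M where "M \<in> ?\<A>" and maxM: "\<forall>X\<in>?\<A>. M \<subseteq> X \<longrightarrow> X = M" ..
  then have M: "is_ideal M" "I \<subseteq> M" "1 \<notin> M" by auto
  have max: "X = M" if "is_ideal X" "1 \<notin> X" "M \<subseteq> X" for X
    using maxM that M(2) by (metis (mono_tags, lifting) mem_Collect_eq order.trans)
  \<comment> \<open>Otherwise M + (a) would be a strictly larger ideal without 1.\<close>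
  have unit: "\<exists>m\<in>M. \<exists>r. 1 = m + r * a" if "a \<notin> M" for a
  proof (rule ccontr)
    assume no: "\<not> ?thesis"
    let ?X = "{m + r * a |m r. m \<in> M}"
    have "is_ideal ?X" unfolding is_ideal_def
    proof (intro conjI ballI allI)
      show "0 \<in> ?X" using is_ideal_zero[OF M(1)] by (auto intro!: exI[of _ 0])
    next
      fix f g assume "f \<in> ?X" "g \<in> ?X"
      then obtain m r m' r' where "m \<in> M" "m' \<in> M" "f = m + r * a" "g = m' + r' * a" by blast
      then have "f + g = (m + m') + (r + r') * a" "m + m' \<in> M"
        using is_ideal_add[OF M(1)] by (auto simp: algebra_simps)
      then show "f + g \<in> ?X" by blast
    next
      fix s f assume "f \<in> ?X"
      then obtain m r where "m \<in> M" "f = m + r * a" by blast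
      then have "s * f = s * m + (s * r) * a" "s * m \<in> M"
        using is_ideal_mult_left[OF M(1)] by (auto simp: algebra_simps)
      then show "s * f \<in> ?X" by blast
    qed
    moreover have "1 \<notin> ?X" using no by blast
    moreover have "M \<subseteq> ?X"
    proof
      fix m assume "m \<in> M"
      then have "m = m + 0 * a \<and> m \<in> M" by simp
      then show "m \<in> ?X" by blast
    qed
    ultimately have "?X = M" by (rule max)
    moreover have "a = 0 + 1 * a \<and> 0 \<in> M" using is_ideal_zero[OF M(1)] by simp
    then have "a \<in> ?X" by blast
    ultimately show False using that by blast
  qed
  have "b \<in> M" if ab: "a * b \<in> M" "a \<notin> M" for a b
  proof -
    obtain m r where "m \<in> M" "1 = m + r * a" using unit[OF ab(2)] by blast
    then have "b = m * b + r * (a * b)" by (metis distrib_right mult.assoc mult_1)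
    then show ?thesis
      using is_idealD(2,3,4)[OF M(1)] ab(1) \<open>m \<in> M\<close> by metis
  qed
  then have "is_prime_ideal M" using M unfolding is_prime_ideal_def by blast
  then show thesis using that M(2) by blast
qed

section \<open>Extension of points\<close>

text \<open>Homomorphisms live on the whole type. One with values in a field that vanishes on
  \<open>A \<inter> P\<close> restricts on \<open>A\<close> to a point of the elimination
  ideal.\<close>

definition ring_hom_fun :: "('a::comm_ring_1 \<Rightarrow> 'b::comm_ring_1) \<Rightarrow> bool" where
  "ring_hom_fun \<phi> \<longleftrightarrow> \<phi> 1 = 1 \<and> (\<forall>x y. \<phi> (x + y) = \<phi> x + \<phi> y \<and> \<phi> (x * y) = \<phi> x * \<phi> y)"

lemma ring_hom_funD:
  assumes "ring_hom_fun \<phi>"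
  shows hom_one: "\<phi> 1 = 1"
    and hom_add: "\<phi> (x + y) = \<phi> x + \<phi> y"
    and hom_mult: "\<phi> (x * y) = \<phi> x * \<phi> y"
    and hom_zero: "\<phi> 0 = 0"
    and hom_diff: "\<phi> (x - y) = \<phi> x - \<phi> y"
proof -
  show "\<phi> 1 = 1" and a: "\<And>x y. \<phi> (x + y) = \<phi> x + \<phi> y" and "\<phi> (x * y) = \<phi> x * \<phi> y"
    using assms unfolding ring_hom_fun_def by blast+
  show "\<phi> 0 = 0" using a[of 0 0] by simp
  show "\<phi> (x - y) = \<phi> x - \<phi> y" using a[of "x - y" y] by simp
qed

lemma hom_sum:
  assumes "ring_hom_fun \<phi>"
  shows "\<phi> (sum f S) = (\<Sum>i\<in>S. \<phi> (f i))"
  by (induction S rule: infinite_finite_induct) (simp_all add: ring_hom_funD[OF assms])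

lemma hom_power:
  assumes "ring_hom_fun \<phi>"
  shows "\<phi> (x ^ n) = \<phi> x ^ n"
  by (induction n) (simp_all add: ring_hom_funD[OF assms])

lemma map_poly_hom:
  assumes "ring_hom_fun \<phi>"
  shows map_poly_hom_add: "map_poly \<phi> (p + q) = map_poly \<phi> p + map_poly \<phi> q"
    and map_poly_hom_diff: "map_poly \<phi> (p - q) = map_poly \<phi> p - map_poly \<phi> q"
    and map_poly_hom_mult: "map_poly \<phi> (p * q) = map_poly \<phi> p * map_poly \<phi> q"
    and map_poly_hom_smult: "map_poly \<phi> (smult c p) = smult (\<phi> c) (map_poly \<phi> p)"
  by (auto intro!: poly_eqI simp: coeff_map_poly coeff_mult hom_sum[OF assms] ring_hom_funD[OF assms])

lemma hom_poly:
  assumes "ring_hom_fun \<phi>"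
  shows "\<phi> (poly p x) = poly (map_poly \<phi> p) (\<phi> x)"
  by (induction p) (simp_all add: map_poly_pCons ring_hom_funD[OF assms])

lemma is_prime_idealD:
  assumes "is_prime_ideal P"
  shows prime_ideal_is_ideal: "is_ideal P"
    and prime_ideal_one: "1 \<notin> P"
    and prime_ideal_cases: "a * b \<in> P \<Longrightarrow> a \<in> P \<or> b \<in> P"
  using assms unfolding is_prime_ideal_def by blast+

lemma prime_ideal_power:
  assumes "is_prime_ideal P" "a \<notin> P"
  shows "a ^ n \<notin> P"
  by (induction n) (use is_prime_idealD[OF assms(1)] assms(2) in auto)

lemma poly_in_ideal:
  assumes "is_ideal P" "p \<in> polys_over P"
  shows "poly p x \<in> P"
  unfolding poly_altdef
  using assms by (intro is_ideal_sum is_ideal_mult_right) (auto intro: coeff_polys_over)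

lemma cong_ideal_trans:
  assumes "is_ideal P" "a - b \<in> P"
  shows "a \<in> P \<longleftrightarrow> b \<in> P"
  using is_ideal_add[OF assms(1) assms(2), of b] is_ideal_diff[OF assms(1) _ assms(2), of a] by auto

lemma degree_minus_lead_term:
  fixes p :: "'a::comm_ring_1 poly"
  assumes "0 < degree p"
  shows "degree (p - monom (lead_coeff p) (degree p)) < degree p"
  using degree_eliminate_lead_coeff[of 1 p] assms by (simp add: monom_0)

text \<open>Otherwise the leading term could be dropped.\<close>

lemma minimal_degree_lead_coeff_notin:
  assumes A: "is_subring A" and P: "is_ideal P" and p: "p \<in> polys_over A" "S p"
    and drop: "\<And>q m. q \<in> polys_over A \<Longrightarrow> S q \<Longrightarrow> m \<in> polys_over A \<Longrightarrow> m \<in> polys_over P \<Longrightarrow> S (q - m)"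
    and not0: "\<not> S 0"
    and min: "\<And>q. q \<in> polys_over A \<Longrightarrow> S q \<Longrightarrow> degree p \<le> degree q"
  shows "lead_coeff p \<notin> P"
proof
  assume l: "lead_coeff p \<in> P"
  let ?m = "monom (lead_coeff p) (degree p)"
  have m: "?m \<in> polys_over A" "?m \<in> polys_over P"
    using coeff_polys_over[OF p(1)] l is_subring_zero[OF A] is_ideal_zero[OF P]
    by (auto simp: polys_over_def)
  have S: "S (p - ?m)" by (rule drop[OF p m])
  show False
  proof (cases "degree p = 0")
    case True
    then have "p - ?m = 0" by (metis degree_0_id diff_self monom_0 of_nat_eq_iff)
    then show False using S not0 by simp
  next
    case False
    then have "degree (p - ?m) < degree p" by (intro degree_minus_lead_term) simp
    moreover have "p - ?m \<in> polys_over A" by (intro is_subring_diff[OF is_subring_polys_over[OF A]] p m)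
    ultimately show False using min S by fastforce
  qed
qed

text \<open>Here \<open>x\<close> is transcendental over the image of \<open>A\<close> modulo \<open>P\<close>.\<close>

lemma extend_transcendental:
  fixes A P :: "'a::comm_ring_1 set" and \<phi> :: "'a \<Rightarrow> 'k::field"
  assumes inf: "infinite (UNIV :: 'k set)" and A: "is_subring A"
    and trans: "\<And>q. q \<in> polys_over A \<Longrightarrow> poly q x \<in> P \<Longrightarrow> q \<in> polys_over P"
    and \<phi>: "ring_hom_fun \<phi>" "\<And>z. z \<in> A \<Longrightarrow> z \<in> P \<Longrightarrow> \<phi> z = 0"
    and j: "\<phi> (coeff G j) \<noteq> 0"
  shows "\<exists>t. (\<forall>q\<in>polys_over A. poly q x \<in> P \<longrightarrow> poly (map_poly \<phi> q) t = 0) \<and>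
    poly (map_poly \<phi> G) t \<noteq> 0"
proof -
  have "coeff (map_poly \<phi> G) j \<noteq> 0" using j by (simp add: coeff_map_poly hom_zero[OF \<phi>(1)])
  then have "map_poly \<phi> G \<noteq> 0" by auto
  from poly_roots_finite[OF this] inf obtain t where t: "poly (map_poly \<phi> G) t \<noteq> 0"
    using ex_new_if_finite by blast
  \<comment> \<open>Every relation of \<open>x\<close> has its coefficients in both \<open>A\<close>
    and \<open>P\<close>, so it imposes no condition on \<open>t\<close>.\<close>
  have "map_poly \<phi> q = 0" if "q \<in> polys_over A" "poly q x \<in> P" for q
    using trans[OF that] coeff_polys_over[OF that(1)] \<phi>(2)
    by (intro poly_eqI) (auto simp: coeff_map_poly hom_zero[OF \<phi>(1)] intro: coeff_polys_over)
  with t show ?thesis by auto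
qed

text \<open>The polynomial \<open>p\<close> plays the role of the minimal polynomial of \<open>x\<close> modulo \<open>P\<close>, and \<open>g / e\<close> that of
  the inverse of \<open>G\<close> evaluated at \<open>x\<close>. Since there are no fractions, Euclidean division is replaced
  by pseudo-division.\<close>

lemma extend_algebraic:
  fixes A P :: "'a::comm_ring_1 set"
  assumes A: "is_subring A" and P: "is_prime_ideal P" and G: "G \<in> polys_over A" "poly G x \<notin> P"
    and q0: "q0 \<in> polys_over A" "poly q0 x \<in> P" "q0 \<notin> polys_over P"
  obtains p e g where "p \<in> polys_over A" "0 < degree p" "lead_coeff p \<notin> P" "poly p x \<in> P"
    "\<And>q. q \<in> polys_over A \<Longrightarrow> poly q x \<in> P \<Longrightarrow> q \<notin> polys_over P \<Longrightarrow> degree p \<le> degree q"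
    "e \<in> A" "e \<notin> P" "g \<in> polys_over A" "e - poly (G * g) x \<in> P"
proof -
  note PA = is_subring_polys_over[OF A] and IP = prime_ideal_is_ideal[OF P]
  have Padd: "p + q \<in> polys_over P" if "p \<in> polys_over P" "q \<in> polys_over P" for p q
    using that is_ideal_add[OF IP] by (auto simp: polys_over_def)
  \<comment> \<open>\<open>S\<close> singles out the nontrivial relations of \<open>x\<close> modulo
    \<open>P\<close>.\<close>
  define S where "S q \<longleftrightarrow> poly q x \<in> P \<and> q \<notin> polys_over P" for q
  obtain p where p: "p \<in> polys_over A" "S p"
    and pmin: "\<And>q. q \<in> polys_over A \<Longrightarrow> S q \<Longrightarrow> degree p \<le> degree q"
    using ex_has_least_nat[of "\<lambda>q. q \<in> polys_over A \<and> S q" q0 degree] q0 unfolding S_def by blast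
  have c: "lead_coeff p \<notin> P"
  proof (rule minimal_degree_lead_coeff_notin[of A P p S])
    show "S (q - m)" if "S q" "m \<in> polys_over P" for q m
      using that is_ideal_diff[OF IP _ poly_in_ideal[OF IP that(2), of x]] Padd[of "q - m" m]
      unfolding S_def by auto
    show "\<not> S 0" unfolding S_def polys_over_def using is_ideal_zero[OF IP] by simp
  qed (use A IP p pmin in auto)
  have dp: "0 < degree p"
  proof (rule ccontr)
    assume "\<not> 0 < degree p"
    then obtain c where "p = [:c:]" using degree_eq_zeroE by blast
    with c p(2) show False unfolding S_def by simp
  qed
  \<comment> \<open>\<open>T u\<close> says that the value of \<open>u\<close> at \<open>x\<close>
    is, modulo \<open>P\<close>, a nonzero multiple of that of \<open>G\<close>. A constant
    \<open>u\<close> of this kind yields \<open>e\<close>, and minimality of the degree will force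
    \<open>u\<close> to be constant.\<close>
  define T where "T u \<longleftrightarrow> poly u x \<notin> P \<and> (\<exists>g\<in>polys_over A. poly u x - poly (G * g) x \<in> P)" for u
  have "T G" unfolding T_def using G is_subring_one[OF PA] is_ideal_zero[OF IP]
    by (auto intro!: bexI[of _ 1])
  then obtain u where u: "u \<in> polys_over A" "T u"
    and umin: "\<And>v. v \<in> polys_over A \<Longrightarrow> T v \<Longrightarrow> degree u \<le> degree v"
    using ex_has_least_nat[of "\<lambda>q. q \<in> polys_over A \<and> T q" G degree] G by blast
  from u(2) obtain g where g: "g \<in> polys_over A" "poly u x - poly (G * g) x \<in> P" and uP: "poly u x \<notin> P"
    unfolding T_def by blast
  have l: "lead_coeff u \<notin> P"
  proof (rule minimal_degree_lead_coeff_notin[of A P u T])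
    show "T (q - m)" if "T q" "m \<in> polys_over P" for q m
    proof -
      have m: "poly m x \<in> P" using that IP by (intro poly_in_ideal)
      obtain g where "g \<in> polys_over A" "poly q x - poly (G * g) x \<in> P" "poly q x \<notin> P"
        using \<open>T q\<close> unfolding T_def by blast
      moreover have "poly (q - m) x \<notin> P"
        using cong_ideal_trans[OF IP, of "poly q x" "poly (q - m) x"] m calculation by simp
      moreover have "poly (q - m) x - poly (G * g) x = (poly q x - poly (G * g) x) - poly m x" by simp
      then have "poly (q - m) x - poly (G * g) x \<in> P"
        using is_ideal_diff[OF IP] m calculation by metis
      ultimately show ?thesis unfolding T_def by blast
    qed
    show "\<not> T 0" unfolding T_def using is_ideal_zero[OF IP] by simp
  qed (use A IP u umin in auto)
  \<comment> \<open>The remainder of \<open>u\<close> on pseudo-division by \<open>p\<close>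
    satisfies \<open>T\<close> too: modulo \<open>P\<close> its value at \<open>x\<close> is that of
    \<open>u\<close> times a power of \<open>lead_coeff p\<close>.\<close>
  have dup: "degree u < degree p"
  proof -
    obtain N h r where d: "h \<in> polys_over A" "r \<in> polys_over A"
      "smult (lead_coeff p ^ N) u = p * h + r" "degree r < degree p"
      using pseudo_division_over[OF A u(1) p(1) dp] by blast
    let ?c = "lead_coeff p ^ N"
    have cA: "?c \<in> A" using p(1) A by (intro is_subring_power coeff_polys_over)
    have "poly p x * poly h x \<in> P" using p(2) is_ideal_mult_right[OF IP] unfolding S_def by blast
    moreover have eq: "?c * poly u x = poly p x * poly h x + poly r x"
      using arg_cong[OF d(3), of "\<lambda>q. poly q x"] by simp
    ultimately have cong: "?c * poly u x - poly r x \<in> P" by simp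
    have "?c * poly u x \<notin> P"
      using prime_ideal_cases[OF P] prime_ideal_power[OF P c] uP by blast
    then have "poly r x \<notin> P" using cong_ideal_trans[OF IP cong] by simp
    moreover have "poly r x - poly (G * smult ?c g) x
        = ?c * (poly u x - poly (G * g) x) - (?c * poly u x - poly r x)"
      by (simp add: algebra_simps)
    then have "poly r x - poly (G * smult ?c g) x \<in> P"
      using is_ideal_diff[OF IP is_ideal_mult_left[OF IP g(2)] cong] by metis
    moreover have "smult ?c g \<in> polys_over A" by (intro smult_polys_over A cA g)
    ultimately have "T r" unfolding T_def by blast
    with umin d show ?thesis by fastforce
  qed
  \<comment> \<open>Otherwise pseudo-division of \<open>p\<close> by \<open>u\<close> leaves a
    quotient and a remainder that are relations of degree below \<open>degree p\<close>, hence
    trivial modulo \<open>P\<close>. Then a power of \<open>lead_coeff u\<close> times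
    \<open>lead_coeff p\<close> lies in \<open>P\<close>.\<close>
  have "degree u = 0"
  proof (rule ccontr)
    assume "degree u \<noteq> 0"
    then have du: "0 < degree u" by simp
    obtain N h r where d: "h \<in> polys_over A" "r \<in> polys_over A"
      "smult (lead_coeff u ^ N) p = u * h + r" "degree r < degree u" "degree h \<le> degree p - degree u"
      using pseudo_division_over[OF A p(1) u(1) du] by blast
    let ?l = "lead_coeff u ^ N"
    have eq: "?l * poly p x = poly u x * poly h x + poly r x"
      using arg_cong[OF d(3), of "\<lambda>q. poly q x"] by simp
    have lp: "?l * poly p x \<in> P" using p(2) is_ideal_mult_left[OF IP] unfolding S_def by blast
    have rP: "poly r x \<in> P"
    proof (rule ccontr)
      assume "poly r x \<notin> P"
      \<comment> \<open>At \<open>x\<close>, \<open>r\<close> is congruent to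
        \<open>- u * h\<close>, again a multiple of \<open>G\<close>; so \<open>T r\<close> would
        contradict the minimality of \<open>u\<close>.\<close>
      moreover have "poly r x - poly (G * (- g * h)) x
          = ?l * poly p x - (poly u x - poly (G * g) x) * poly h x"
        unfolding eq by (simp add: algebra_simps)
      then have "poly r x - poly (G * (- g * h)) x \<in> P"
        using is_ideal_diff[OF IP lp is_ideal_mult_right[OF IP g(2)]] by metis
      moreover have "- g * h \<in> polys_over A" by (intro is_subringD(4,5)[OF PA] g d)
      ultimately have "T r" unfolding T_def by blast
      with umin[OF d(2)] d(4) show False by simp
    qed
    then have r: "r \<in> polys_over P" using pmin[OF d(2)] d(4) dup unfolding S_def by fastforce
    have "poly u x * poly h x = ?l * poly p x - poly r x" unfolding eq by simp
    then have "poly u x * poly h x \<in> P" using is_ideal_diff[OF IP lp rP] by simp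
    then have "poly h x \<in> P" using prime_ideal_cases[OF P] uP by blast
    \<comment> \<open>This uses the degree bound on the quotient together with
      \<open>0 < degree u\<close>.\<close>
    moreover have "degree h < degree p" using d(5) du dup by linarith
    ultimately have h: "h \<in> polys_over P" using pmin[OF d(1)] unfolding S_def by fastforce
    have "coeff (u * h + r) (degree p) \<in> P"
      unfolding coeff_add coeff_mult
      by (intro is_ideal_add[OF IP] is_ideal_sum[OF IP] is_ideal_mult_left[OF IP] coeff_polys_over[OF h] coeff_polys_over[OF r])
    then have "?l * lead_coeff p \<in> P" unfolding d(3)[symmetric] by simp
    then show False using prime_ideal_cases[OF P] prime_ideal_power[OF P l] c by blast
  qed
  then have "poly u x = lead_coeff u" by (simp add: poly_altdef)
  moreover have "lead_coeff u \<in> A" by (rule coeff_polys_over[OF u(1)])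
  ultimately show thesis
    using that[OF p(1) dp c, of "lead_coeff u" g] p(2) pmin l g unfolding S_def by auto
qed

text \<open>Elimination of one variable: nonvanishing of \<open>G\<close> is traded for nonvanishing
  of one element \<open>a\<close> of the smaller ring, chosen independently of
  \<open>\<phi>\<close>.\<close>

lemma extend_point:
  fixes A P :: "'a::comm_ring_1 set"
  assumes ac: "\<And>p :: 'k::field poly. 0 < degree p \<Longrightarrow> \<exists>t. poly p t = 0"
    and inf: "infinite (UNIV :: 'k set)"
    and A: "is_subring A" and P: "is_prime_ideal P" and G: "G \<in> polys_over A" "poly G x \<notin> P"
  obtains a where "a \<in> A" "a \<notin> P"
    "\<And>\<phi> :: 'a \<Rightarrow> 'k. ring_hom_fun \<phi> \<Longrightarrow> (\<And>z. z \<in> A \<Longrightarrow> z \<in> P \<Longrightarrow> \<phi> z = 0) \<Longrightarrow> \<phi> a \<noteq> 0 \<Longrightarrow>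
      \<exists>t. (\<forall>q\<in>polys_over A. poly q x \<in> P \<longrightarrow> poly (map_poly \<phi> q) t = 0) \<and>
        poly (map_poly \<phi> G) t \<noteq> 0"
proof (cases "\<forall>q\<in>polys_over A. poly q x \<in> P \<longrightarrow> q \<in> polys_over P")
  case True
  have "G \<notin> polys_over P" using poly_in_ideal[OF prime_ideal_is_ideal[OF P]] G(2) by blast
  then obtain j where j: "coeff G j \<notin> P" unfolding polys_over_def by blast
  \<comment> \<open>Any coefficient of \<open>G\<close> outside \<open>P\<close> serves as
    \<open>a\<close>.\<close>
  show thesis
    by (rule that[OF coeff_polys_over[OF G(1)] j], rule extend_transcendental[OF inf A])
      (use True in auto)
next
  case False
  then obtain q0 where "q0 \<in> polys_over A" "poly q0 x \<in> P" "q0 \<notin> polys_over P" by blast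
  from extend_algebraic[OF A P G this] obtain p e g
    where p: "p \<in> polys_over A" "0 < degree p" "lead_coeff p \<notin> P" "poly p x \<in> P"
      and pmin: "\<And>q. q \<in> polys_over A \<Longrightarrow> poly q x \<in> P \<Longrightarrow> q \<notin> polys_over P \<Longrightarrow> degree p \<le> degree q"
      and e: "e \<in> A" "e \<notin> P" and g: "g \<in> polys_over A" "e - poly (G * g) x \<in> P"
    by metis
  let ?c = "lead_coeff p"
  have cA: "?c \<in> A" by (rule coeff_polys_over[OF p(1)])
  show thesis
  \<comment> \<open>The factor \<open>?c\<close> preserves the degree of \<open>p\<close> under
    \<open>\<phi>\<close>, so that a root exists; the factor \<open>e\<close> keeps \<open>G\<close>
    nonzero at that root.\<close>
  proof (rule that[of "?c * e"])
    show "?c * e \<in> A" by (intro is_subring_mult[OF A] cA e)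
    show "?c * e \<notin> P" using prime_ideal_cases[OF P] p(3) e(2) by blast
    fix \<phi> :: "'a \<Rightarrow> 'k"
    assume \<phi>: "ring_hom_fun \<phi>" and van: "\<And>z. z \<in> A \<Longrightarrow> z \<in> P \<Longrightarrow> \<phi> z = 0" and "\<phi> (?c * e) \<noteq> 0"
    note hom = ring_hom_funD[OF \<phi>] map_poly_hom[OF \<phi>]
    have nz: "\<phi> ?c \<noteq> 0" "\<phi> e \<noteq> 0" using \<open>\<phi> (?c * e) \<noteq> 0\<close> by (auto simp: hom)
    then have "coeff (map_poly \<phi> p) (degree p) \<noteq> 0" by (simp add: coeff_map_poly hom)
    then have "0 < degree (map_poly \<phi> p)" using le_degree p(2) by fastforce
    then obtain t where t: "poly (map_poly \<phi> p) t = 0" using ac by blast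
    \<comment> \<open>Pseudo-division by \<open>p\<close> leaves a relation of smaller degree, hence
      trivial modulo \<open>P\<close>. Up to a nonzero factor, the image of \<open>q\<close> is
      therefore a multiple of that of \<open>p\<close>.\<close>
    have ann: "poly (map_poly \<phi> q) t = 0" if q: "q \<in> polys_over A" "poly q x \<in> P" for q
    proof -
      obtain N h r where d: "h \<in> polys_over A" "r \<in> polys_over A"
        "smult (?c ^ N) q = p * h + r" "degree r < degree p"
        using pseudo_division_over[OF A q(1) p(1,2)] by blast
      have "?c ^ N * poly q x = poly p x * poly h x + poly r x"
        using arg_cong[OF d(3), of "\<lambda>q. poly q x"] by simp
      then have "poly r x = ?c ^ N * poly q x - poly p x * poly h x" by simp
      then have "poly r x \<in> P"
        using is_idealD(3,4,6)[OF prime_ideal_is_ideal[OF P]] p(4) q(2) by metis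
      then have "r \<in> polys_over P" using pmin[OF d(2)] d(4) by fastforce
      then have "map_poly \<phi> r = 0"
        using d(2) by (intro poly_eqI) (auto simp: coeff_map_poly hom intro!: van coeff_polys_over)
      then have "smult (\<phi> ?c ^ N) (map_poly \<phi> q) = map_poly \<phi> p * map_poly \<phi> h"
        using arg_cong[OF d(3), of "map_poly \<phi>"] by (simp add: hom hom_power[OF \<phi>])
      from arg_cong[OF this, of "\<lambda>q. poly q t"] show ?thesis using t nz by simp
    qed
    \<comment> \<open>This polynomial is a relation of \<open>x\<close>; at \<open>t\<close> it
      makes the value of \<open>G\<close> a factor of the nonzero \<open>\<phi> e\<close>.\<close>
    have "monom e 0 - G * g \<in> polys_over A"
      by (intro is_subringD(3,4)[OF is_subring_polys_over[OF A]] monom_polys_over A e G g)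
    from ann[OF this] have "\<phi> e = poly (map_poly \<phi> G) t * poly (map_poly \<phi> g) t"
      using g(2) by (simp add: hom map_poly_monom poly_monom)
    then show "\<exists>t. (\<forall>q\<in>polys_over A. poly q x \<in> P \<longrightarrow> poly (map_poly \<phi> q) t = 0) \<and>
        poly (map_poly \<phi> G) t \<noteq> 0"
      using ann nz by (intro exI[of _ t]) auto
  qed
qed

section \<open>Evaluation of multivariate polynomials\<close>

text \<open>A finitely supported map is a sum of \<open>single\<close> terms. The rule serves for
  polynomials and for their exponent vectors alike.\<close>

lemma poly_mapping_single_add_induct [case_names zero single add]:
  assumes "P 0" "\<And>m c. P (Poly_Mapping.single m c)" "\<And>f g. P f \<Longrightarrow> P g \<Longrightarrow> P (f + g)"
  shows "P (f :: 'a \<Rightarrow>\<^sub>0 'b::comm_monoid_add)"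
proof -
  have "f = (\<Sum>m\<in>Poly_Mapping.keys f. Poly_Mapping.single m (Poly_Mapping.lookup f m))"
    by (rule poly_mapping_eqI)
      (auto simp: lookup_sum lookup_single when_def not_in_keys_iff_lookup_eq_zero)
  moreover have "P (\<Sum>m\<in>S. Poly_Mapping.single m (Poly_Mapping.lookup f m))" for S
    by (induction S rule: infinite_finite_induct) (auto intro: assms)
  ultimately show ?thesis by metis
qed

text \<open>Over a common finite set of monomials sums can be compared termwise, even when
  cancellation shrinks a support.\<close>

lemma mpoly_eval_superset:
  assumes "finite K" "Poly_Mapping.keys f \<subseteq> K"
  shows "mpoly_eval f a =
    (\<Sum>m\<in>K. Poly_Mapping.lookup f m * (\<Prod>i\<in>UNIV. (a $ i) ^ Poly_Mapping.lookup m i))"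
  unfolding mpoly_eval_def
  using assms by (intro sum.mono_neutral_left) (auto simp: not_in_keys_iff_lookup_eq_zero)

lemma mpoly_eval_zero: "mpoly_eval 0 a = 0"
  by (simp add: mpoly_eval_def)

lemma mpoly_eval_single:
  "mpoly_eval (Poly_Mapping.single m c) a = c * (\<Prod>i\<in>UNIV. (a $ i) ^ Poly_Mapping.lookup m i)"
  by (subst mpoly_eval_superset[of "{m}"]) (auto split: if_splits)

lemma mpoly_eval_add: "mpoly_eval (f + g) a = mpoly_eval f a + mpoly_eval g a"
  by (subst (1 2 3) mpoly_eval_superset[of "Poly_Mapping.keys f \<union> Poly_Mapping.keys g"])
    (use Poly_Mapping.keys_add[of f g] in \<open>auto simp: lookup_add algebra_simps sum.distrib\<close>)

text \<open>Both sides are additive in \<open>f\<close> and in \<open>g\<close>, so single terms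
  suffice, and there the exponents add.\<close>

lemma mpoly_eval_mult: "mpoly_eval (f * g) a = mpoly_eval f a * mpoly_eval g a"
proof (induction f rule: poly_mapping_single_add_induct)
  case (single m c)
  show ?case
    by (induction g rule: poly_mapping_single_add_induct)
      (simp_all add: mult_single mpoly_eval_single mpoly_eval_zero mpoly_eval_add lookup_add
        power_add prod.distrib algebra_simps)
qed (simp_all add: mpoly_eval_zero mpoly_eval_add algebra_simps)

lemma mpoly_eval_const: "mpoly_eval (Poly_Mapping.single 0 c) a = c"
  by (simp add: mpoly_eval_single)

lemma ring_hom_fun_mpoly_eval: "ring_hom_fun (\<lambda>f. mpoly_eval f a)"
  unfolding ring_hom_fun_def
  using mpoly_eval_const[of 1 a] by (simp add: mpoly_eval_add mpoly_eval_mult)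

section \<open>Rings in some of the variables\<close>

definition mpoly_var :: "'n \<Rightarrow> ('k::field, 'n::finite) mpoly" where
  "mpoly_var i = Poly_Mapping.single (Poly_Mapping.single i 1) 1"

lemma mpoly_eval_var: "mpoly_eval (mpoly_var i) a = a $ i"
proof -
  have "(\<Prod>j\<in>UNIV. (a $ j) ^ Poly_Mapping.lookup (Poly_Mapping.single i (1::nat)) j)
      = (\<Prod>j\<in>UNIV. if j = i then a $ j else 1)"
    by (rule prod.cong) (auto simp: lookup_single when_def)
  then show ?thesis by (simp add: mpoly_var_def mpoly_eval_single)
qed

text \<open>The ring k[X_i : i in xs] as a tower over the constants, one variable adjoined at a
  time; inductions on the list climb this tower.\<close>

fun mpolys_in :: "'n list \<Rightarrow> ('k::field, 'n::finite) mpoly set" where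
  "mpolys_in [] = range (Poly_Mapping.single 0)"
| "mpolys_in (i # xs) = (\<lambda>p. poly p (mpoly_var i)) ` polys_over (mpolys_in xs)"

lemma is_subring_mpolys_in: "is_subring (mpolys_in xs)"
proof (induction xs)
  case Nil
  show ?case
    unfolding is_subring_def
    by (auto simp: mult_single simp flip: single_diff intro: range_eqI[of _ _ 1])
next
  case (Cons i xs)
  then show ?case by (simp add: is_subring_image_poly)
qed

lemma const_in_mpolys_in: "Poly_Mapping.single 0 c \<in> mpolys_in xs"
proof (induction xs)
  case (Cons i xs)
  then show ?case using subset_image_poly[OF is_subring_mpolys_in[of xs]] by fastforce
qed simp

lemma var_in_mpolys_in: "i \<in> set xs \<Longrightarrow> mpoly_var i \<in> mpolys_in xs"
proof (induction xs)
  case (Cons j xs)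
  then show ?case
    using subset_image_poly[OF is_subring_mpolys_in[of xs], of "mpoly_var j"]
      generator_in_image_poly[OF is_subring_mpolys_in[of xs]] by auto
qed simp

text \<open>Every monomial is a product of powers of variables.\<close>

lemma mpolys_in_UNIV:
  assumes "set xs = UNIV"
  shows "mpolys_in xs = (UNIV :: ('k::field, 'n::finite) mpoly set)"
proof -
  note S = is_subring_mpolys_in[of xs]
  have mon: "Poly_Mapping.single m 1 \<in> (mpolys_in xs :: ('k, 'n) mpoly set)" for m
  proof (induction m rule: poly_mapping_single_add_induct)
    case zero
    show ?case by (rule const_in_mpolys_in)
  next
    case (single i n)
    have "Poly_Mapping.single (Poly_Mapping.single i n) 1 = (mpoly_var i ^ n :: ('k, 'n) mpoly)"
    proof (induction n)
      case (Suc n)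
      have "Poly_Mapping.single (Poly_Mapping.single i (Suc n)) 1 =
          (mpoly_var i * Poly_Mapping.single (Poly_Mapping.single i n) 1 :: ('k, 'n) mpoly)"
        by (simp add: mpoly_var_def mult_single flip: single_add)
      then show ?case by (simp only: Suc power_Suc)
    qed simp
    then show ?case using is_subring_power[OF S var_in_mpolys_in] assms by simp
  next
    case (add f g)
    from is_subring_mult[OF S add] show ?case by (simp add: mult_single)
  qed
  have "f \<in> mpolys_in xs" for f :: "('k, 'n) mpoly"
  proof (induction f rule: poly_mapping_single_add_induct)
    case zero
    show ?case by (rule is_subring_zero[OF S])
  next
    case (single m c)
    from is_subring_mult[OF S const_in_mpolys_in[of c] mon[of m]] show ?case
      by (simp add: mult_single)
  next
    case (add f g)
    then show ?case by (rule is_subring_add[OF S])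
  qed
  then show ?thesis by blast
qed

text \<open>This permits changing one coordinate without disturbing the polynomials free of that
  variable.\<close>

lemma mpoly_eval_cong:
  assumes "f \<in> mpolys_in xs" "\<And>i. i \<in> set xs \<Longrightarrow> a $ i = b $ i"
  shows "mpoly_eval f a = mpoly_eval f b"
  using assms
proof (induction xs arbitrary: f)
  case Nil
  then show ?case by (auto simp: mpoly_eval_const)
next
  case (Cons i xs)
  then obtain p where p: "p \<in> polys_over (mpolys_in xs)" "f = poly p (mpoly_var i)" by auto
  have "map_poly (\<lambda>f. mpoly_eval f a) p = map_poly (\<lambda>f. mpoly_eval f b) p"
    using Cons coeff_polys_over[OF p(1)]
    by (intro poly_eqI) (simp add: coeff_map_poly mpoly_eval_zero)
  then show ?case
    using Cons.prems(2) by (simp add: p hom_poly[OF ring_hom_fun_mpoly_eval] mpoly_eval_var)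
qed

text \<open>The constants form a field, where any nonzero element generates everything; each further
  variable is Hilbert's theorem followed by a quotient.\<close>

lemma noetherian_on_mpolys_in: "noetherian_on (mpolys_in xs :: ('k::field, 'n::finite) mpoly set)"
proof (induction xs)
  case Nil
  let ?A = "mpolys_in [] :: ('k, 'n) mpoly set"
  show ?case
    unfolding noetherian_on_def
  proof (intro allI impI)
    fix I assume I: "I \<subseteq> ?A"
    show "\<exists>F\<subseteq>I. finite F \<and> I \<subseteq> ideal_over ?A F"
    proof (cases "I \<subseteq> {0}")
      case True
      then show ?thesis by (intro exI[of _ "{}"]) (auto intro: ideal_over.zero)
    next
      case False
      then obtain u where u: "u \<in> I" "u \<noteq> 0" by blast
      then obtain c where c: "u = Poly_Mapping.single 0 c" using I by auto
      with u have "c \<noteq> 0" by auto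
      have "Poly_Mapping.single 0 d \<in> ideal_over ?A {u}" for d
      proof -
        have "Poly_Mapping.single 0 (d / c) * u \<in> ideal_over ?A {u}"
          by (intro ideal_over.scale ideal_over.gen) auto
        then show ?thesis using c \<open>c \<noteq> 0\<close> by (simp add: mult_single)
      qed
      then show ?thesis using I u by (intro exI[of _ "{u}"]) auto
    qed
  qed
next
  case (Cons i xs)
  then show ?case
    by (simp add: noetherian_on_image_poly noetherian_on_polys_over is_subring_mpolys_in)
qed

lemma noetherian_on_mpoly: "noetherian_on (UNIV :: ('k::field, 'n::finite) mpoly set)"
proof -
  obtain xs :: "'n list" where "set xs = UNIV" using finite_list[OF finite] by blast
  then show ?thesis using noetherian_on_mpolys_in[of xs] by (simp add: mpolys_in_UNIV)
qed

section \<open>Algebraically closed fields\<close>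

text \<open>Over a finite field, 1 plus the product of all X - a takes the value 1
  everywhere.\<close>

lemma infinite_algebraically_closed:
  assumes "\<And>p :: 'k::field poly. 0 < degree p \<Longrightarrow> \<exists>t. poly p t = 0"
  shows "infinite (UNIV :: 'k set)"
proof
  assume fin: "finite (UNIV :: 'k set)"
  let ?q = "\<Prod>a\<in>(UNIV :: 'k set). [:- a, 1:]"
  have "degree ?q = card (UNIV :: 'k set)" by (subst degree_prod_sum_eq) auto
  then have dq: "0 < degree ?q" using fin by (simp add: card_gt_0_iff)
  then have "degree (1 + ?q) = degree ?q" by (intro degree_add_eq_right) simp
  with dq assms obtain t where "poly (1 + ?q) t = 0" by metis
  moreover have "poly ?q t = 0" using fin by (auto simp: poly_prod)
  ultimately show False by simp
qed

text \<open>The extra \<open>b\<close> carries the induction: the point found for fewer variables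
  must avoid the zeros of the element supplied by \<open>extend_point\<close>.\<close>

lemma prime_ideal_point:
  fixes P :: "('k::field, 'n::finite) mpoly set"
  assumes ac: "\<And>p :: 'k poly. 0 < degree p \<Longrightarrow> \<exists>t. poly p t = 0"
    and P: "is_prime_ideal P"
    and "distinct xs" "b \<in> mpolys_in xs" "b \<notin> P"
  shows "\<exists>a. (\<forall>f\<in>mpolys_in xs. f \<in> P \<longrightarrow> mpoly_eval f a = 0) \<and> mpoly_eval b a \<noteq> 0"
  using assms(3-)
proof (induction xs arbitrary: b)
  case Nil
  \<comment> \<open>A nonzero constant is a unit and so lies outside the prime ideal.\<close>
  have no_const: "c = 0" if "Poly_Mapping.single 0 c \<in> P" for c
  proof (rule ccontr)
    assume "c \<noteq> 0"
    with is_ideal_mult_left[OF prime_ideal_is_ideal[OF P] that, of "Poly_Mapping.single 0 (1 / c)"]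
    show False using prime_ideal_one[OF P] by (simp add: mult_single)
  qed
  then have "mpoly_eval b a \<noteq> 0" for a
    using Nil is_ideal_zero[OF prime_ideal_is_ideal[OF P]] by (auto simp: mpoly_eval_const)
  then show ?case using no_const by (auto simp: mpoly_eval_const)
next
  case (Cons i xs)
  let ?A = "mpolys_in xs"
  from Cons.prems obtain G where G: "G \<in> polys_over ?A" "b = poly G (mpoly_var i)" by auto
  have "poly G (mpoly_var i) \<notin> P" using G Cons.prems by simp
  from extend_point[OF ac infinite_algebraically_closed[OF ac] is_subring_mpolys_in P G(1) this]
  obtain c where c: "c \<in> ?A" "c \<notin> P"
    and ext: "\<And>\<phi> :: _ \<Rightarrow> 'k. ring_hom_fun \<phi> \<Longrightarrow> (\<And>z. z \<in> ?A \<Longrightarrow> z \<in> P \<Longrightarrow> \<phi> z = 0) \<Longrightarrow> \<phi> c \<noteq> 0 \<Longrightarrow>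
      \<exists>t. (\<forall>q\<in>polys_over ?A. poly q (mpoly_var i) \<in> P \<longrightarrow> poly (map_poly \<phi> q) t = 0) \<and>
        poly (map_poly \<phi> G) t \<noteq> 0"
    by blast
  obtain a where a: "\<forall>f\<in>?A. f \<in> P \<longrightarrow> mpoly_eval f a = 0" "mpoly_eval c a \<noteq> 0"
    using Cons.IH[OF _ c] Cons.prems by auto
  let ?\<phi> = "\<lambda>f. mpoly_eval f a"
  obtain t where t: "\<forall>q\<in>polys_over ?A. poly q (mpoly_var i) \<in> P \<longrightarrow> poly (map_poly ?\<phi> q) t = 0"
    "poly (map_poly ?\<phi> G) t \<noteq> 0"
    using ext[OF ring_hom_fun_mpoly_eval[of a]] a by blast
  \<comment> \<open>Overwriting coordinate \<open>i\<close> leaves all values on \<open>?A\<close>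
    unchanged, because \<open>i\<close> does not occur in \<open>xs\<close>.\<close>
  define a' where "a' = (\<chi> j. if j = i then t else a $ j)"
  have ev: "mpoly_eval (poly q (mpoly_var i)) a' = poly (map_poly ?\<phi> q) t"
    if "q \<in> polys_over ?A" for q
  proof -
    have "mpoly_eval f a' = mpoly_eval f a" if "f \<in> ?A" for f
      using that by (rule mpoly_eval_cong) (use Cons.prems in \<open>auto simp: a'_def\<close>)
    then have "map_poly (\<lambda>f. mpoly_eval f a') q = map_poly ?\<phi> q"
      using coeff_polys_over[OF that] by (intro poly_eqI) (simp add: coeff_map_poly mpoly_eval_zero)
    moreover have "a' $ i = t" by (simp add: a'_def)
    ultimately show ?thesis by (simp add: hom_poly[OF ring_hom_fun_mpoly_eval] mpoly_eval_var)
  qed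
  show ?case using t by (intro exI[of _ a']) (auto simp: ev G)
qed

lemma weak_nullstellensatz:
  fixes I :: "('k::field, 'n::finite) mpoly set"
  assumes ac: "\<And>p :: 'k poly. 0 < degree p \<Longrightarrow> \<exists>t. poly p t = 0"
    and I: "is_ideal I" "1 \<notin> I"
  shows "algebraic_set I \<noteq> {}"
proof -
  obtain P where P: "is_prime_ideal P" "I \<subseteq> P" using ex_prime_ideal[OF I] .
  obtain xs :: "'n list" where xs: "set xs = UNIV" "distinct xs"
    using finite_distinct_list[OF finite] by blast
  \<comment> \<open>With \<open>b = 1\<close> the nonvanishing condition is void.\<close>
  obtain a where "\<forall>f\<in>mpolys_in xs. f \<in> P \<longrightarrow> mpoly_eval f a = 0"
    using prime_ideal_point[OF ac P(1) xs(2), of 1] prime_ideal_one[OF P(1)]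
    by (auto simp: mpolys_in_UNIV[OF xs(1)])
  then have "a \<in> algebraic_set I"
    using P(2) by (auto simp: algebraic_set_def mpolys_in_UNIV[OF xs(1)])
  then show ?thesis by blast
qed

section \<open>Fields that are not algebraically closed\<close>

text \<open>For \<open>y = 0\<close> only the top power of \<open>x\<close> survives; otherwise
  dividing by \<open>y ^ degree p\<close> would make \<open>x / y\<close> a root of
  \<open>p\<close>.\<close>

lemma homogenization_eq_zero:
  fixes p :: "'k::field poly"
  assumes "0 < degree p" "\<And>t. poly p t \<noteq> 0"
    and 0: "(\<Sum>i\<le>degree p. coeff p i * x ^ i * y ^ (degree p - i)) = 0"
  shows "x = 0 \<and> y = 0"
proof (cases "y = 0")
  case True
  have "(\<Sum>i\<le>degree p. coeff p i * x ^ i * y ^ (degree p - i)) =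
      (\<Sum>i\<le>degree p. if i = degree p then coeff p i * x ^ i else 0)"
    by (rule sum.cong) (auto simp: True)
  then have "lead_coeff p * x ^ degree p = 0" using 0 by simp
  then show ?thesis using True assms(1) by auto
next
  case False
  have "y ^ degree p * poly p (x / y) = (\<Sum>i\<le>degree p. coeff p i * x ^ i * y ^ (degree p - i))"
    unfolding poly_altdef sum_distrib_left
    by (rule sum.cong) (auto simp: False power_diff field_simps)
  then have "y ^ degree p * poly p (x / y) = 0" using 0 by simp
  then show ?thesis using False assms(2) by simp
qed

text \<open>Substituting \<open>f\<close> and \<open>g\<close> into the homogenized \<open>p\<close>
  gives \<open>h\<close>: at a zero of \<open>h\<close> the two values form a zero of that form,
  hence both are 0.\<close>

lemma ex_common_zeros_pair:
  fixes p :: "'k::field poly" and I :: "('k, 'n::finite) mpoly set"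
  assumes p: "0 < degree p" "\<And>t. poly p t \<noteq> 0" and I: "is_ideal I" "f \<in> I" "g \<in> I"
  shows "\<exists>h\<in>I. \<forall>a. mpoly_eval h a = 0 \<longrightarrow> mpoly_eval f a = 0 \<and> mpoly_eval g a = 0"
proof -
  let ?h = "\<Sum>i\<le>degree p. Poly_Mapping.single 0 (coeff p i) * f ^ i * g ^ (degree p - i)"
  have hI: "?h \<in> I"
  proof (rule is_ideal_sum[OF I(1)])
    fix i assume "i \<in> {..degree p}"
    show "Poly_Mapping.single 0 (coeff p i) * f ^ i * g ^ (degree p - i) \<in> I"
    proof (cases i)
      case 0
      \<comment> \<open>The term with \<open>i = 0\<close> has no factor \<open>f\<close>; as
        \<open>p\<close> has positive degree, it has a factor \<open>g\<close>.\<close>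
      have "g ^ degree p = g ^ (degree p - 1) * g" by (rule power_minus_mult[OF p(1), symmetric])
      then have "g ^ degree p \<in> I" using is_ideal_mult_left[OF I(1,3)] by simp
      then show ?thesis using 0 is_ideal_mult_left[OF I(1)] by simp
    next
      case (Suc j)
      have "f ^ i \<in> I" using is_ideal_mult_right[OF I(1,2)] Suc by simp
      then show ?thesis using is_ideal_mult_left[OF I(1)] is_ideal_mult_right[OF I(1)] by blast
    qed
  qed
  have ev: "mpoly_eval ?h a =
      (\<Sum>i\<le>degree p. coeff p i * mpoly_eval f a ^ i * mpoly_eval g a ^ (degree p - i))" for a
    by (simp add: hom_sum[OF ring_hom_fun_mpoly_eval] hom_power[OF ring_hom_fun_mpoly_eval]
        mpoly_eval_mult mpoly_eval_const)
  show ?thesis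
  proof (intro bexI[OF _ hI] allI impI)
    fix a assume "mpoly_eval ?h a = 0"
    then show "mpoly_eval f a = 0 \<and> mpoly_eval g a = 0"
      unfolding ev by (rule homogenization_eq_zero[OF p])
  qed
qed

lemma ex_common_zeros_finite:
  fixes p :: "'k::field poly" and I :: "('k, 'n::finite) mpoly set"
  assumes p: "0 < degree p" "\<And>t. poly p t \<noteq> 0" and I: "is_ideal I" and F: "finite F" "F \<subseteq> I"
  shows "\<exists>h\<in>I. \<forall>a. mpoly_eval h a = 0 \<longrightarrow> (\<forall>f\<in>F. mpoly_eval f a = 0)"
  using F
proof (induction F)
  case empty
  then show ?case using is_ideal_zero[OF I] by blast
next
  case (insert f F)
  then obtain g where g: "g \<in> I" "\<forall>a. mpoly_eval g a = 0 \<longrightarrow> (\<forall>f\<in>F. mpoly_eval f a = 0)"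
    by auto
  with ex_common_zeros_pair[OF p I, of f g] insert.prems show ?case by auto
qed

lemma mpoly_eval_ideal_over:
  assumes "f \<in> ideal_over UNIV F" "\<And>g. g \<in> F \<Longrightarrow> mpoly_eval g a = 0"
  shows "mpoly_eval f a = 0"
  using assms(1)
  by induction (simp_all add: mpoly_eval_zero mpoly_eval_add mpoly_eval_mult assms(2))

theorem theorem1p1:
  fixes I :: "('k::field, 'n::finite) mpoly set"
  assumes "is_ideal I"
  shows "(\<forall>f\<in>I. \<exists>a :: 'k ^ 'n. mpoly_eval f a = 0) \<longleftrightarrow> algebraic_set I \<noteq> {}"
proof
  assume "algebraic_set I \<noteq> {}"
  then show "\<forall>f\<in>I. \<exists>a. mpoly_eval f a = 0" unfolding algebraic_set_def by blast
next
  assume zeros: "\<forall>f\<in>I. \<exists>a. mpoly_eval f a = 0"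
  show "algebraic_set I \<noteq> {}"
  proof (cases "\<forall>p :: 'k poly. 0 < degree p \<longrightarrow> (\<exists>t. poly p t = 0)")
    case True
    have "1 \<notin> I"
    proof
      assume "1 \<in> I"
      then obtain a :: "'k ^ 'n" where "mpoly_eval 1 a = 0" using zeros by blast
      then show False using hom_one[OF ring_hom_fun_mpoly_eval[of a]] by simp
    qed
    with True assms show ?thesis by (intro weak_nullstellensatz) auto
  next
    case False
    then obtain p :: "'k poly" where p: "0 < degree p" "\<And>t. poly p t \<noteq> 0" by blast
    obtain F where F: "F \<subseteq> I" "finite F" "I \<subseteq> ideal_over UNIV F"
      using noetherian_onE[OF noetherian_on_mpoly subset_UNIV] .
    \<comment> \<open>Condition (i) for the single element \<open>h\<close> of \<open>I\<close>
      yields a common zero of \<open>F\<close>, hence of \<open>I\<close>.\<close>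
    obtain h a where "\<forall>a. mpoly_eval h a = 0 \<longrightarrow> (\<forall>f\<in>F. mpoly_eval f a = 0)" "mpoly_eval h a = 0"
      using ex_common_zeros_finite[OF p assms F(2,1)] zeros by blast
    then have "a \<in> algebraic_set I"
      using F(3) mpoly_eval_ideal_over unfolding algebraic_set_def by blast
    then show ?thesis by blast
  qed
qed

end
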